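(* Let $n\ge 1$. Then $G_n$ is a normal subgroup of $\widetilde{G}_n$ and the quotient $\widetilde{G}_n/G_n$ is isomorphic to $\mathbb{Z}^{n-1}$; that is, there is an exact sequence of groups $$0\longrightarrow G_n\longrightarrow \widetilde{G}_n\longrightarrow \mathbb{Z}^{n-1}\longrightarrow 0 .$$
   Context: $\mathbb{N}=\{1,2,3,\dots\}$. For $n\ge 1$ let $X=Y=\mathbb{N}$ and $S=(X\times Y)\times\{1,\dots,n\}$; pairs in $X\times Y$ are ordered componentwise: $(x,y)\ge(x_0,y_0)$ iff $x\ge x_0$ and $y\ge y_0$. Maps act on the right, and $\alpha\beta$ means first $\alpha$, then $\beta$. $\widetilde{G}_n$ is the group of all permutations $g$ of $S$ for which there is a $p_0=(x_0,y_0)\in X\times Y$ such that: ($\widetilde{\mathrm{B}}$1) there is $((m_{11},m_{12}),\dots,(m_{n1},m_{n2}))\in(\mathbb{Z}^2)^n$ with $((x,y),i)\,g=((x+m_{i1},y+m_{i2}),i)$ for all $(x,y)\ge p_0$ and all $i=1,\dots,n$; (B2a) for every $(x,i)\in X\times\{1,\dots,n\}$ there are $q\in\mathbb{Z}$ and $(x',i')\in X\times\{1,\dots,n\}$ with $((x,y),i)\,g=((x',y+q),i')$ for all $y\ge y_0$; (B2b) for every $(y,i)\in Y\times\{1,\dots,n\}$ there are $r\in\mathbb{Z}$ and $(y',i')\in Y\times\{1,\dots,n\}$ with $((x,y),i)\,g=((x+r,y'),i')$ for all $x\ge x_0$. $G_n$ is the group of all permutations $g$ of $S$ for which there is a $p_0=(x_0,y_0)$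 such that (B2a), (B2b) hold and, in place of ($\widetilde{\mathrm{B}}$1), (B1): there is $(m_1,\dots,m_n)\in\mathbb{Z}^n$ with $((x,y),i)\,g=((x+m_i,y+m_i),i)$ for all $(x,y)\ge p_0$ and all $i=1,\dots,n$. *)

theory Defs
  imports "HOL-Algebra.Product_Groups" "HOL-Combinatorics.Permutations"
begin

text \<open>The natural numbers of the source start at 1. They are taken as a subset of \<^typ>\<open>int\<close>, so
  that translations by integers need neither coercions nor truncation.\<close>

definition X_set :: "int set" where "X_set = {1..}"

definition Y_set :: "int set" where "Y_set = {1..}"

type_synonym point = "(int \<times> int) \<times> nat"

definition S_set :: "nat \<Rightarrow> point set" where
  "S_set n = (X_set \<times> Y_set) \<times> {1..n}"

text \<open>A permutation of \<^term>\<open>A\<close> is a function with \<^term>\<open>g permutes A\<close>, which in particular is the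
  identity outside \<^term>\<open>A\<close>. Maps act on the right, so the product \<open>\<alpha>\<beta>\<close> is \<open>\<beta> \<circ> \<alpha>\<close>.\<close>

definition Sym :: "'a set \<Rightarrow> ('a \<Rightarrow> 'a) monoid" where
  "Sym A = \<lparr>carrier = {g. g permutes A}, monoid.mult = (\<lambda>\<alpha> \<beta>. \<beta> \<circ> \<alpha>), one = id\<rparr>"

text \<open>Tuples indexed by \<open>1, \<dots>, n\<close> are functions on \<^typ>\<open>nat\<close> of which only the values on
  \<open>{1..n}\<close> are used.\<close>

definition B1_tilde :: "nat \<Rightarrow> int \<times> int \<Rightarrow> (point \<Rightarrow> point) \<Rightarrow> bool" where
  "B1_tilde n p\<^sub>0 g \<longleftrightarrow>
     (\<exists>m :: nat \<Rightarrow> int \<times> int. \<forall>i\<in>{1..n}. \<forall>x y. x \<ge> fst p\<^sub>0 \<and> y \<ge> snd p\<^sub>0 \<longrightarrow>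
        g ((x, y), i) = ((x + fst (m i), y + snd (m i)), i))"

definition B1 :: "nat \<Rightarrow> int \<times> int \<Rightarrow> (point \<Rightarrow> point) \<Rightarrow> bool" where
  "B1 n p\<^sub>0 g \<longleftrightarrow>
     (\<exists>m :: nat \<Rightarrow> int. \<forall>i\<in>{1..n}. \<forall>x y. x \<ge> fst p\<^sub>0 \<and> y \<ge> snd p\<^sub>0 \<longrightarrow>
        g ((x, y), i) = ((x + m i, y + m i), i))"

definition B2a :: "nat \<Rightarrow> int \<times> int \<Rightarrow> (point \<Rightarrow> point) \<Rightarrow> bool" where
  "B2a n p\<^sub>0 g \<longleftrightarrow>
     (\<forall>x\<in>X_set. \<forall>i\<in>{1..n}. \<exists>q. \<exists>x'\<in>X_set. \<exists>i'\<in>{1..n}. \<forall>y\<ge>snd p\<^sub>0.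
        g ((x, y), i) = ((x', y + q), i'))"

definition B2b :: "nat \<Rightarrow> int \<times> int \<Rightarrow> (point \<Rightarrow> point) \<Rightarrow> bool" where
  "B2b n p\<^sub>0 g \<longleftrightarrow>
     (\<forall>y\<in>Y_set. \<forall>i\<in>{1..n}. \<exists>r. \<exists>y'\<in>Y_set. \<exists>i'\<in>{1..n}. \<forall>x\<ge>fst p\<^sub>0.
        g ((x, y), i) = ((x + r, y'), i'))"

definition G_tilde_group :: "nat \<Rightarrow> (point \<Rightarrow> point) monoid" where
  "G_tilde_group n = (Sym (S_set n))\<lparr>carrier :=
     {g. g permutes S_set n \<and> (\<exists>p\<^sub>0 \<in> X_set \<times> Y_set. B1_tilde n p\<^sub>0 g \<and> B2a n p\<^sub>0 g \<and> B2b n p\<^sub>0 g)}\<rparr>"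

definition G_group :: "nat \<Rightarrow> (point \<Rightarrow> point) monoid" where
  "G_group n = (Sym (S_set n))\<lparr>carrier :=
     {g. g permutes S_set n \<and> (\<exists>p\<^sub>0 \<in> X_set \<times> Y_set. B1 n p\<^sub>0 g \<and> B2a n p\<^sub>0 g \<and> B2b n p\<^sub>0 g)}\<rparr>"

definition Z_power :: "nat \<Rightarrow> (nat \<Rightarrow> int) monoid" where
  "Z_power k = product_group {1..k} (\<lambda>_. integer_group)"

end

(* If g translates the i-th quadrant by (a i, b i) far out, then g permutes the columns, acting on
   them by a permutation of X x {1..n} that is eventually translation by a i on the i-th ray. Counting
   the points of a large initial segment of the rays and of its image gives sum a = 0; by symmetry
   sum b = 0. Hence the homomorphism g |-> (a i - b i) for i < n has kernel G_n: if the first n - 1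
   differences vanish, so does the last. It is onto since all the rows of two quadrants i and n can be
   glued to lines and shifted by k, which adds k to a i, -k to a n and leaves b unchanged. *)

theory Submission
  imports Defs
begin

section \<open>Permutations of the quadrants\<close>

abbreviation inv' :: "('a \<Rightarrow> 'b) \<Rightarrow> 'b \<Rightarrow> 'a"
  where "inv' f \<equiv> Hilbert_Choice.inv f"

lemma bij_permutesI:
  assumes "bij g" "\<And>P. P \<notin> S \<Longrightarrow> g P = P"
  shows "g permutes S"
  using assms by (simp add: permutes_def bij_iff)

lemma mem_S_set [simp]: "((x, y), i) \<in> S_set n \<longleftrightarrow> 1 \<le> x \<and> 1 \<le> y \<and> i \<in> {1..n}"
  by (auto simp: S_set_def X_set_def Y_set_def)

lemma permutes_preimage:
  assumes "g permutes S_set n" "P \<in> S_set n"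
  obtains u v j where "g ((u, v), j) = P" "inv' g P = ((u, v), j)" "1 \<le> u" "1 \<le> v" "j \<in> {1..n}"
proof -
  obtain u v j where uvj: "inv' g P = ((u, v), j)"
    by (metis surj_pair)
  moreover have "inv' g P \<in> S_set n"
    using assms by (simp add: permutes_in_image[OF permutes_inv])
  ultimately show thesis
    using that permutes_inverses(1)[OF assms(1), of P] by simp
qed

lemma B2a_mono: "B2a n p g \<Longrightarrow> snd p \<le> snd p' \<Longrightarrow> B2a n p' g"
  unfolding B2a_def by (meson order_trans)

lemma B2b_mono: "B2b n p g \<Longrightarrow> fst p \<le> fst p' \<Longrightarrow> B2b n p' g"
  unfolding B2b_def by (meson order_trans)

section \<open>Exchanging the two coordinates\<close>

definition flip :: "point \<Rightarrow> point" where
  "flip P = (prod.swap (fst P), snd P)"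

text \<open>Conjugation by \<open>flip\<close> swaps rows with columns, hence \<open>B2a\<close>
  with \<open>B2b\<close>. It lets every fact about columns be carried over to rows, and
  conversely.\<close>

definition transposed :: "(point \<Rightarrow> point) \<Rightarrow> point \<Rightarrow> point" where
  "transposed g = flip \<circ> g \<circ> flip"

lemma flip_pair [simp]: "flip ((x, y), i) = ((y, x), i)"
  by (simp add: flip_def)

lemma flip_flip [simp]: "flip (flip P) = P"
  by (simp add: flip_def)

lemma flip_eq_iff: "flip P = Q \<longleftrightarrow> P = flip Q"
  by auto

lemma bij_flip: "bij flip"
  by (rule o_bij[where g = flip]) (auto simp: fun_eq_iff)

lemma flip_in_S_set [simp]: "flip P \<in> S_set n \<longleftrightarrow> P \<in> S_set n"
  by (auto simp: S_set_def X_set_def Y_set_def flip_def mem_Times_iff)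

lemma transposed_transposed [simp]: "transposed (transposed g) = g"
  by (simp add: transposed_def fun_eq_iff)

lemma transposed_comp: "transposed (h \<circ> g) = transposed h \<circ> transposed g"
  by (simp add: transposed_def fun_eq_iff)

lemma transposed_permutes:
  assumes "g permutes S_set n"
  shows "transposed g permutes S_set n"
proof (rule bij_permutesI)
  show "bij (transposed g)"
    unfolding transposed_def using bij_flip permutes_bij[OF assms] by (intro bij_comp)
  show "transposed g P = P" if "P \<notin> S_set n" for P
    using that assms by (simp add: transposed_def permutes_not_in)
qed

lemma inv_transposed:
  assumes "g permutes S_set n"
  shows "inv' (transposed g) = transposed (inv' g)"
proof
  fix P
  show "inv' (transposed g) P = transposed (inv' g) P"
    unfolding permutes_inv_eq[OF transposed_permutes[OF assms]]
    using permutes_inverses[OF assms] by (simp add: transposed_def)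
qed

lemma B2a_transposed: "B2a n p (transposed g) \<longleftrightarrow> B2b n (prod.swap p) g"
  unfolding B2a_def B2b_def transposed_def
  by (simp add: X_set_def Y_set_def flip_eq_iff)

lemma B2b_transposed: "B2b n p (transposed g) \<longleftrightarrow> B2a n (prod.swap p) g"
  using B2a_transposed[of n "prod.swap p" "transposed g"] by simp

section \<open>Images of strips, and the row and column conditions for inverses\<close>

text \<open>Beyond \<open>fst p\<close> each row keeps a constant image height, so the finitely many
  rows below \<open>V\<close> attain only finitely many heights.\<close>

lemma B2b_strip:
  assumes "B2b n p g"
  obtains H where
    "\<And>x y i. 1 \<le> x \<Longrightarrow> 1 \<le> y \<Longrightarrow> y < V \<Longrightarrow> i \<in> {1..n} \<Longrightarrow> snd (fst (g ((x, y), i))) < H"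
proof -
  define f where "f P = snd (fst (g P))" for P
  \<comment> \<open>The maximum with 1 keeps the column that represents all columns beyond
    \<open>fst p\<close> inside the finite box, even when \<open>fst p\<close> is below 1.\<close>
  define A where "A = f ` (({1..max (fst p) 1} \<times> {1..<V}) \<times> {1..n})"
  have "f ((x, y), i) \<in> A" if "1 \<le> x" "1 \<le> y" "y < V" "i \<in> {1..n}" for x y i
  proof (cases "x \<le> fst p")
    case True
    then show ?thesis
      using that by (auto simp: A_def)
  next
    case False
    obtain r y' i' where "\<And>x. x \<ge> fst p \<Longrightarrow> g ((x, y), i) = ((x + r, y'), i')"
      using assms \<open>1 \<le> y\<close> \<open>i \<in> {1..n}\<close> unfolding B2b_def Y_set_def by (metis atLeast_iff)
    then have "f ((x, y), i) = f ((max (fst p) 1, y), i)"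
      using False by (simp add: f_def)
    then show ?thesis
      using that by (auto simp: A_def)
  qed
  then have "f ((x, y), i) < Max A + 1" if "1 \<le> x" "1 \<le> y" "y < V" "i \<in> {1..n}" for x y i
    using that Max_ge[of A] by (fastforce simp: A_def)
  then show thesis
    using that unfolding f_def by blast
qed

lemma B2a_strip:
  assumes "B2a n p g"
  obtains H where
    "\<And>x y i. 1 \<le> x \<Longrightarrow> 1 \<le> y \<Longrightarrow> x < V \<Longrightarrow> i \<in> {1..n} \<Longrightarrow> fst (fst (g ((x, y), i))) < H"
proof -
  have "B2b n (prod.swap p) (transposed g)"
    using assms by (simp add: B2b_transposed)
  then obtain H where H: "\<And>x y i. 1 \<le> x \<Longrightarrow> 1 \<le> y \<Longrightarrow> y < V \<Longrightarrow> i \<in> {1..n} \<Longrightarrow>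
      snd (fst (transposed g ((x, y), i))) < H"
    using B2b_strip by blast
  have "snd (fst (transposed g ((y, x), i))) = fst (fst (g ((x, y), i)))" for x y i
    by (simp add: transposed_def flip_def)
  with H that show thesis
    by metis
qed

text \<open>A low strip is mapped below some height \<open>K\<close>, so a point of height at least \<open>K\<close> has its preimage
  in a part of a column on which \<^term>\<open>g\<close> is a translation; one such point determines \<^term>\<open>inv' g\<close> on
  the whole end of its column, from the same height on for all columns.\<close>

lemma B2a_inv:
  assumes g: "g permutes S_set n" and a: "B2a n p g" and b: "B2b n p' g"
  obtains H where "B2a n (c, H) (inv' g)"
proof -
  obtain K where K: "\<And>x y i. 1 \<le> x \<Longrightarrow> 1 \<le> y \<Longrightarrow> y < snd p \<Longrightarrow> i \<in> {1..n} \<Longrightarrow>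
      snd (fst (g ((x, y), i))) < K"
    using B2b_strip[OF b] by blast
  define H where "H = max K 1"
  have "B2a n (c, H) (inv' g)"
    unfolding B2a_def
  proof (intro ballI)
    fix x :: int and i assume x: "x \<in> X_set" and i: "i \<in> {1..n}"
    have "((x, H), i) \<in> S_set n"
      using x i by (simp add: H_def X_set_def)
    then obtain u v j where uvj: "g ((u, v), j) = ((x, H), i)" "1 \<le> u" "1 \<le> v" "j \<in> {1..n}"
      using permutes_preimage[OF g] by blast
    have v: "snd p \<le> v"
      using K[of u v j] uvj by (force simp: H_def)
    obtain q x' i' where q: "\<And>y. y \<ge> snd p \<Longrightarrow> g ((u, y), j) = ((x', y + q), i')"
      using a \<open>1 \<le> u\<close> \<open>j \<in> {1..n}\<close> unfolding B2a_def X_set_def by (metis atLeast_iff)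
    have "x' = x" "i' = i" "v + q = H"
      using q[OF v] uvj(1) by auto
    then have "g ((u, y - q), j) = ((x, y), i)" if "y \<ge> H" for y
      using q[of "y - q"] v that by simp
    then have "\<forall>y\<ge>H. inv' g ((x, y), i) = ((u, y + (- q)), j)"
      by (simp add: permutes_inv_eq[OF g])
    then show "\<exists>q. \<exists>x'\<in>X_set. \<exists>i'\<in>{1..n}. \<forall>y\<ge>snd (c, H). inv' g ((x, y), i) = ((x', y + q), i')"
      using uvj by (intro exI[of _ "- q"] bexI[of _ u] bexI[of _ j]) (simp_all add: X_set_def)
  qed
  then show thesis
    by (rule that)
qed

lemma B2b_inv:
  assumes g: "g permutes S_set n" and a: "B2a n p g" and b: "B2b n p' g"
  obtains H where "B2b n (H, c) (inv' g)"
proof -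
  obtain H where "B2a n (c, H) (inv' (transposed g))"
  proof (rule B2a_inv[OF transposed_permutes[OF g]])
    show "B2a n (prod.swap p') (transposed g)" "B2b n (prod.swap p) (transposed g)"
      using a b by (simp_all add: B2a_transposed B2b_transposed)
  qed
  then have "B2b n (H, c) (inv' g)"
    by (simp add: inv_transposed[OF g] B2a_transposed)
  then show thesis
    by (rule that)
qed

section \<open>Escape from strips, and the row and column conditions for products\<close>

text \<open>This is the strip bound read backwards: \<open>inv' g\<close> maps the strip below
  \<open>V\<close> under some height \<open>H\<close>, so no point at height \<open>H\<close> or
  more can land below \<open>V\<close>.\<close>

lemma B2a_escape:
  assumes g: "g permutes S_set n" and "B2b n p (inv' g)"
  obtains H where "\<And>x y i. 1 \<le> x \<Longrightarrow> 1 \<le> y \<Longrightarrow> H \<le> y \<Longrightarrow> i \<in> {1..n} \<Longrightarrow> V \<le> snd (fst (g ((x, y), i)))"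
proof -
  obtain H where H: "\<And>x y i. 1 \<le> x \<Longrightarrow> 1 \<le> y \<Longrightarrow> y < V \<Longrightarrow> i \<in> {1..n} \<Longrightarrow>
      snd (fst (inv' g ((x, y), i))) < H"
    using B2b_strip[OF assms(2)] by blast
  have "V \<le> snd (fst (g ((x, y), i)))" if "1 \<le> x" "1 \<le> y" "H \<le> y" "i \<in> {1..n}" for x y i
  proof (rule ccontr)
    assume less: "\<not> V \<le> snd (fst (g ((x, y), i)))"
    obtain u v j where uvj: "g ((x, y), i) = ((u, v), j)"
      by (metis surj_pair)
    have "((u, v), j) \<in> S_set n"
      using permutes_in_image[OF g, of "((x, y), i)"] uvj that by simp
    moreover have "inv' g ((u, v), j) = ((x, y), i)"
      using uvj by (simp add: permutes_inv_eq[OF g])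
    ultimately show False
      using H[of u v j] less uvj that by simp
  qed
  then show thesis
    by (rule that)
qed

lemma B2b_escape:
  assumes g: "g permutes S_set n" and "B2a n p (inv' g)"
  obtains H where "\<And>x y i. 1 \<le> x \<Longrightarrow> 1 \<le> y \<Longrightarrow> H \<le> x \<Longrightarrow> i \<in> {1..n} \<Longrightarrow> V \<le> fst (fst (g ((x, y), i)))"
proof -
  have "B2b n (prod.swap p) (inv' (transposed g))"
    using assms by (simp add: inv_transposed B2b_transposed)
  then obtain H where H: "\<And>x y i. 1 \<le> x \<Longrightarrow> 1 \<le> y \<Longrightarrow> H \<le> y \<Longrightarrow> i \<in> {1..n} \<Longrightarrow>
      V \<le> snd (fst (transposed g ((x, y), i)))"
    using B2a_escape[OF transposed_permutes[OF g]] by blast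
  have "snd (fst (transposed g ((y, x), i))) = fst (fst (g ((x, y), i)))" for x y i
    by (simp add: transposed_def flip_def)
  with H that show thesis
    by metis
qed

text \<open>On each column the translations of \<open>g\<close> and \<open>h\<close> add up. The
  issue is a starting height common to all columns, since the shift \<open>q\<close> depends on the
  column; the escape bound supplies it.\<close>

lemma B2a_comp:
  assumes g: "g permutes S_set n" and ga: "B2a n p g" and gb: "B2b n p' g" and ha: "B2a n r h"
  obtains H where "B2a n (c, H) (h \<circ> g)"
proof -
  obtain K where "B2b n (K, 0) (inv' g)"
    using B2b_inv[OF g ga gb] by blast
  then obtain L where L: "\<And>x y i. 1 \<le> x \<Longrightarrow> 1 \<le> y \<Longrightarrow> L \<le> y \<Longrightarrow> i \<in> {1..n} \<Longrightarrow>
      snd r \<le> snd (fst (g ((x, y), i)))"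
    using B2a_escape[OF g] by blast
  define H where "H = max (max L (snd p)) 1"
  have "B2a n (c, H) (h \<circ> g)"
    unfolding B2a_def
  proof (intro ballI)
    fix x :: int and i assume x: "x \<in> X_set" and i: "i \<in> {1..n}"
    obtain q x' i' where x': "x' \<in> X_set" "i' \<in> {1..n}"
      and q: "\<And>y. y \<ge> snd p \<Longrightarrow> g ((x, y), i) = ((x', y + q), i')"
      using ga x i unfolding B2a_def by metis
    obtain q' x'' i'' where x'': "x'' \<in> X_set" "i'' \<in> {1..n}"
      and q': "\<And>y. y \<ge> snd r \<Longrightarrow> h ((x', y), i') = ((x'', y + q'), i'')"
      using ha x' unfolding B2a_def by metis
    have "(h \<circ> g) ((x, y), i) = ((x'', y + (q + q')), i'')" if "y \<ge> H" for y
    proof -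
      have gy: "g ((x, y), i) = ((x', y + q), i')"
        using q that by (simp add: H_def)
      moreover have "snd r \<le> y + q"
        using L[of x y i] gy that x i by (simp add: H_def X_set_def)
      ultimately show ?thesis
        using q' by (simp add: add.assoc)
    qed
    then show "\<exists>q. \<exists>x'\<in>X_set. \<exists>i'\<in>{1..n}. \<forall>y\<ge>snd (c, H). (h \<circ> g) ((x, y), i) = ((x', y + q), i')"
      using x'' by (metis snd_conv)
  qed
  then show thesis
    by (rule that)
qed

lemma B2b_comp:
  assumes g: "g permutes S_set n" and ga: "B2a n p g" and gb: "B2b n p' g" and hb: "B2b n r h"
  obtains H where "B2b n (H, c) (h \<circ> g)"
proof -
  obtain H where "B2a n (c, H) (transposed h \<circ> transposed g)"
  proof (rule B2a_comp[OF transposed_permutes[OF g]])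
    show "B2a n (prod.swap p') (transposed g)" "B2b n (prod.swap p) (transposed g)"
      "B2a n (prod.swap r) (transposed h)"
      using ga gb hb by (simp_all add: B2a_transposed B2b_transposed)
  qed
  then have "B2b n (H, c) (h \<circ> g)"
    by (simp add: B2a_transposed flip: transposed_comp)
  then show thesis
    by (rule that)
qed

section \<open>Permutations with given translation vectors\<close>

definition translates :: "nat \<Rightarrow> int \<times> int \<Rightarrow> (nat \<Rightarrow> int) \<Rightarrow> (nat \<Rightarrow> int) \<Rightarrow> (point \<Rightarrow> point) \<Rightarrow> bool" where
  "translates n p a b g \<longleftrightarrow>
     (\<forall>i\<in>{1..n}. \<forall>x\<ge>fst p. \<forall>y\<ge>snd p. g ((x, y), i) = ((x + a i, y + b i), i))"

text \<open>The translation vectors are explicit parameters, so that their behaviour under products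
  and inverses can be stated. Membership in the larger group means admissibility for some
  \<open>a\<close> and \<open>b\<close>, membership in the smaller one means admissibility with
  \<open>b = a\<close>.\<close>

definition admissible :: "nat \<Rightarrow> (nat \<Rightarrow> int) \<Rightarrow> (nat \<Rightarrow> int) \<Rightarrow> (point \<Rightarrow> point) \<Rightarrow> bool" where
  "admissible n a b g \<longleftrightarrow>
     g permutes S_set n \<and> (\<exists>p\<in>X_set \<times> Y_set. translates n p a b g \<and> B2a n p g \<and> B2b n p g)"

text \<open>Each condition survives an increase of its base point, so three separate base points can
  be replaced by their maximum; the entry 1 puts it into
  \<open>X_set \<times> Y_set\<close>.\<close>

lemma admissibleI:
  assumes "g permutes S_set n" "translates n p a b g" "B2a n p' g" "B2b n p'' g"
  shows "admissible n a b g"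
proof -
  define r where "r = (max 1 (max (fst p) (fst p'')), max 1 (max (snd p) (snd p')))"
  have "translates n r a b g"
    using assms(2) by (simp add: translates_def r_def)
  moreover have "B2a n r g" "B2b n r g"
    using B2a_mono[OF assms(3), of r] B2b_mono[OF assms(4), of r] by (simp_all add: r_def)
  moreover have "r \<in> X_set \<times> Y_set"
    by (simp add: r_def X_set_def Y_set_def)
  ultimately show ?thesis
    using assms(1) unfolding admissible_def by blast
qed

lemma admissible_id: "admissible n (\<lambda>_. 0) (\<lambda>_. 0) id"
  by (rule admissibleI[where p = "(1, 1)" and p' = "(1, 1)" and p'' = "(1, 1)"])
    (auto simp: translates_def B2a_def B2b_def permutes_id intro!: exI[of _ 0])

lemma admissible_transposed:
  assumes "admissible n a b g"
  shows "admissible n b a (transposed g)"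
proof -
  obtain p where p: "translates n p a b g" "B2a n p g" "B2b n p g" and g: "g permutes S_set n"
    using assms unfolding admissible_def by blast
  have "translates n (prod.swap p) b a (transposed g)"
    using p(1) by (simp add: translates_def transposed_def)
  then show ?thesis
    using p transposed_permutes[OF g]
    by (intro admissibleI[where p = "prod.swap p" and p' = "prod.swap p" and p'' = "prod.swap p"])
      (simp_all add: B2a_transposed B2b_transposed)
qed

text \<open>The strips outside the quadrant at \<open>p\<close> have images with one coordinate
  bounded. A point beyond both bounds therefore has its preimage in the part where \<open>g\<close>
  translates, and is translated back.\<close>

lemma admissible_inv:
  assumes "admissible n a b g"
  shows "admissible n (\<lambda>i. - a i) (\<lambda>i. - b i) (inv' g)"
proof -
  obtain p where p: "translates n p a b g" "B2a n p g" "B2b n p g" and g: "g permutes S_set n"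
    using assms unfolding admissible_def by blast
  obtain H where H: "B2a n (0, H) (inv' g)"
    using B2a_inv[OF g p(2,3)] .
  obtain K where K: "B2b n (K, 0) (inv' g)"
    using B2b_inv[OF g p(2,3)] .
  obtain M where M: "\<And>x y i. 1 \<le> x \<Longrightarrow> 1 \<le> y \<Longrightarrow> x < fst p \<Longrightarrow> i \<in> {1..n} \<Longrightarrow> fst (fst (g ((x, y), i))) < M"
    using B2a_strip[OF p(2)] by blast
  obtain N where N: "\<And>x y i. 1 \<le> x \<Longrightarrow> 1 \<le> y \<Longrightarrow> y < snd p \<Longrightarrow> i \<in> {1..n} \<Longrightarrow> snd (fst (g ((x, y), i))) < N"
    using B2b_strip[OF p(3)] by blast
  have "translates n (max M 1, max N 1) (\<lambda>i. - a i) (\<lambda>i. - b i) (inv' g)"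
    unfolding translates_def fst_conv snd_conv
  proof (intro ballI allI impI)
    fix i x y assume i: "i \<in> {1..n}" and xy: "max M 1 \<le> x" "max N 1 \<le> y"
    have "((x, y), i) \<in> S_set n"
      using i xy by simp
    then obtain u v j where uvj: "g ((u, v), j) = ((x, y), i)" "inv' g ((x, y), i) = ((u, v), j)"
      "1 \<le> u" "1 \<le> v" "j \<in> {1..n}"
      using permutes_preimage[OF g] by blast
    have "fst p \<le> u" "snd p \<le> v"
      using M[of u v j] N[of u v j] uvj xy by force+
    then have "g ((u, v), j) = ((u + a j, v + b j), j)"
      using p(1) uvj by (simp add: translates_def)
    then show "inv' g ((x, y), i) = ((x + - a i, y + - b i), i)"
      using uvj by auto
  qed
  then show ?thesis
    using H K permutes_inv[OF g] by (intro admissibleI)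
qed

text \<open>By the escape bounds, \<open>g\<close> carries points far out in both directions into
  the part where \<open>h\<close> translates, so the vectors add.\<close>

lemma admissible_comp:
  assumes "admissible n a b g" "admissible n c d h"
  shows "admissible n (\<lambda>i. a i + c i) (\<lambda>i. b i + d i) (h \<circ> g)"
proof -
  obtain p where p: "translates n p a b g" "B2a n p g" "B2b n p g" and g: "g permutes S_set n"
    using assms(1) unfolding admissible_def by blast
  obtain r where r: "translates n r c d h" "B2a n r h" "B2b n r h" and h: "h permutes S_set n"
    using assms(2) unfolding admissible_def by blast
  obtain H where H: "B2a n (0, H) (h \<circ> g)"
    using B2a_comp[OF g p(2,3) r(2)] .
  obtain K where K: "B2b n (K, 0) (h \<circ> g)"
    using B2b_comp[OF g p(2,3) r(3)] .
  obtain H' where H': "B2a n (0, H') (inv' g)"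
    using B2a_inv[OF g p(2,3)] .
  obtain K' where K': "B2b n (K', 0) (inv' g)"
    using B2b_inv[OF g p(2,3)] .
  obtain M where M: "\<And>x y i. 1 \<le> x \<Longrightarrow> 1 \<le> y \<Longrightarrow> M \<le> x \<Longrightarrow> i \<in> {1..n} \<Longrightarrow> fst r \<le> fst (fst (g ((x, y), i)))"
    using B2b_escape[OF g H'] by blast
  obtain N where N: "\<And>x y i. 1 \<le> x \<Longrightarrow> 1 \<le> y \<Longrightarrow> N \<le> y \<Longrightarrow> i \<in> {1..n} \<Longrightarrow> snd r \<le> snd (fst (g ((x, y), i)))"
    using B2a_escape[OF g K'] by blast
  have "translates n (max (max M 1) (fst p), max (max N 1) (snd p))
      (\<lambda>i. a i + c i) (\<lambda>i. b i + d i) (h \<circ> g)"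
    unfolding translates_def fst_conv snd_conv
  proof (intro ballI allI impI)
    fix i x y assume i: "i \<in> {1..n}" and xy: "max (max M 1) (fst p) \<le> x" "max (max N 1) (snd p) \<le> y"
    have gxy: "g ((x, y), i) = ((x + a i, y + b i), i)"
      using p(1) i xy by (simp add: translates_def)
    moreover have "fst r \<le> x + a i" "snd r \<le> y + b i"
      using M[of x y i] N[of x y i] gxy i xy by simp_all
    ultimately show "(h \<circ> g) ((x, y), i) = ((x + (a i + c i), y + (b i + d i)), i)"
      using r(1) i by (simp add: translates_def)
  qed
  then show ?thesis
    using H K permutes_compose[OF g h] by (intro admissibleI)
qed

text \<open>Two descriptions of \<open>g\<close> agree at a point beyond both base points. This
  makes the later homomorphism well defined.\<close>

lemma admissible_unique:
  assumes "admissible n a b g" "admissible n c d g" "i \<in> {1..n}"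
  shows "a i = c i" "b i = d i"
proof -
  obtain p r where "translates n p a b g" "translates n r c d g"
    using assms unfolding admissible_def by blast
  then have "((max (fst p) (fst r) + a i, max (snd p) (snd r) + b i), i) =
      ((max (fst p) (fst r) + c i, max (snd p) (snd r) + d i), i)"
    using assms(3) unfolding translates_def by (metis max.cobounded1 max.cobounded2)
  then show "a i = c i" "b i = d i"
    by auto
qed

section \<open>The translation lengths in each direction sum to zero\<close>

text \<open>A bijection that maps the tails of the rays onto shifted tails maps the finite
  complements onto each other; equating their sizes gives the claim.\<close>

lemma eventual_translation_sum_zero:
  fixes \<sigma> :: "int \<times> nat \<Rightarrow> int \<times> nat" and m :: "nat \<Rightarrow> int"
  assumes bij: "bij_betw \<sigma> ({1..} \<times> {1..n}) ({1..} \<times> {1..n})"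
    and trans: "\<And>x i. x \<ge> N \<Longrightarrow> i \<in> {1..n} \<Longrightarrow> \<sigma> (x, i) = (x + m i, i)"
  shows "(\<Sum>i\<in>{1..n}. m i) = 0"
proof -
  \<comment> \<open>The cut lies beyond \<open>N\<close>, so the tails are translated. The added sum
    of absolute values keeps every shifted cut \<open>M + m i\<close> at 1 or more.\<close>
  define M where "M = max 1 N + (\<Sum>i\<in>{1..n}. \<bar>m i\<bar>)"
  have abs_le: "\<bar>m i\<bar> \<le> (\<Sum>i\<in>{1..n}. \<bar>m i\<bar>)" if "i \<in> {1..n}" for i
    using that by (intro member_le_sum) auto
  have "0 \<le> (\<Sum>i\<in>{1..n}. \<bar>m i\<bar>)"
    by (simp add: sum_nonneg)
  then have M: "M \<ge> 1" "M \<ge> N"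
    unfolding M_def by linarith+
  have Mm: "M + m i \<ge> 1" if "i \<in> {1..n}" for i
    using abs_le[OF that] unfolding M_def by linarith
  define D where "D = ({1..} :: int set) \<times> {1..n}"
  define T where "T = {M..} \<times> {1..n}"
  \<comment> \<open>The finite complements are written with the ray index first, so that their
    cardinality is a sum over the rays; \<open>prod.swap\<close> restores the order of the
    pairs.\<close>
  define A where "A = (SIGMA i:{1..n}. {1..<M})"
  define B where "B = (SIGMA i:{1..n}. {1..<M + m i})"
  have "\<sigma> ` T = {(x, i). i \<in> {1..n} \<and> M + m i \<le> x}" (is "_ = ?R")
  proof
    show "\<sigma> ` T \<subseteq> ?R"
      using trans M by (auto simp: T_def)
    show "?R \<subseteq> \<sigma> ` T"
    proof clarify
      fix x i assume "i \<in> {1..n}" "M + m i \<le> x"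
      then show "(x, i) \<in> \<sigma> ` T"
        using trans[of "x - m i" i] M by (intro image_eqI[of _ _ "(x - m i, i)"]) (auto simp: T_def)
    qed
  qed
  moreover have "T \<subseteq> D"
    using M by (auto simp: T_def D_def)
  moreover have inj: "inj_on \<sigma> D" and "\<sigma> ` D = D"
    using bij by (auto simp: bij_betw_def D_def)
  ultimately have "\<sigma> ` (D - T) = D - ?R"
    using inj_on_image_set_diff[of \<sigma> D D T] by auto
  then have "card (D - T) = card (D - ?R)"
    using card_image[OF inj_on_subset[OF inj Diff_subset[of D T]]] by simp
  moreover have "D - T = prod.swap ` A" "D - ?R = prod.swap ` B"
    by (auto simp: D_def T_def A_def B_def)
  ultimately have "card A = card B"
    by (simp add: card_image)
  then have "(\<Sum>i\<in>{1..n}. nat (M - 1)) = (\<Sum>i\<in>{1..n}. nat (M + m i - 1))"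
    by (simp add: A_def B_def)
  then have count: "(\<Sum>i\<in>{1..n}. int (nat (M - 1))) = (\<Sum>i\<in>{1..n}. int (nat (M + m i - 1)))"
    by (simp only: of_nat_sum[symmetric] of_nat_eq_iff)
  \<comment> \<open>The shifted cut is at least 1, so \<open>nat\<close> truncates nothing and the
    count can be read over the integers.\<close>
  have "int (nat (M + m i - 1)) = (M - 1) + m i" if "i \<in> {1..n}" for i
    using Mm[OF that] by simp
  then have "(\<Sum>i\<in>{1..n}. int (nat (M + m i - 1))) = (\<Sum>i\<in>{1..n}. (M - 1) + m i)"
    by (rule sum.cong[OF refl])
  moreover have "int (nat (M - 1)) = M - 1"
    using M by simp
  ultimately show ?thesis
    using count by (simp only: sum.distrib)
qed

text \<open>The upper ends of the columns are permuted by \<open>g\<close>. Indexing columns by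
  pairs \<open>(x, i)\<close> turns this into a bijection \<sigma> that is eventually translation by
  \<open>a i\<close>, to which the counting lemma applies.\<close>

lemma admissible_sum_fst:
  assumes "admissible n a b g"
  shows "(\<Sum>i\<in>{1..n}. a i) = 0"
proof -
  obtain p where p: "translates n p a b g" "B2a n p g" "B2b n p g" and g: "g permutes S_set n"
    using assms unfolding admissible_def by blast
  \<comment> \<open>Here \<open>c\<close> is a column, \<open>c'\<close> the column receiving its
    upper end and \<open>q\<close> the vertical shift; both are chosen as functions of
    \<open>c\<close> below.\<close>
  have "\<forall>c\<in>{1..} \<times> {1..n}. \<exists>c' q. c' \<in> {1..} \<times> {1..n} \<and>
      (\<forall>y\<ge>snd p. g ((fst c, y), snd c) = ((fst c', y + q), snd c'))"
  proof
    fix c :: "int \<times> nat" assume "c \<in> {1..} \<times> {1..n}"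
    then obtain q x' i' where "x' \<in> {1..}" "i' \<in> {1..n}"
      "\<forall>y\<ge>snd p. g ((fst c, y), snd c) = ((x', y + q), i')"
      using p(2) unfolding B2a_def X_set_def by (metis mem_Times_iff)
    then show "\<exists>c' q. c' \<in> {1..} \<times> {1..n} \<and>
        (\<forall>y\<ge>snd p. g ((fst c, y), snd c) = ((fst c', y + q), snd c'))"
      by (intro exI[of _ "(x', i')"] exI[of _ q]) simp
  qed
  from bchoice[OF this] obtain \<sigma> where "\<forall>c\<in>{1..} \<times> {1..n}. \<exists>q. \<sigma> c \<in> {1..} \<times> {1..n} \<and>
      (\<forall>y\<ge>snd p. g ((fst c, y), snd c) = ((fst (\<sigma> c), y + q), snd (\<sigma> c)))"
    by blast
  from bchoice[OF this] obtain q where \<sigma>q: "\<forall>c\<in>{1..} \<times> {1..n}. \<sigma> c \<in> {1..} \<times> {1..n} \<and>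
      (\<forall>y\<ge>snd p. g ((fst c, y), snd c) = ((fst (\<sigma> c), y + q c), snd (\<sigma> c)))"
    by blast
  have mem: "\<sigma> c \<in> {1..} \<times> {1..n}" if "c \<in> {1..} \<times> {1..n}" for c
    using \<sigma>q that by blast
  have \<sigma>: "g ((x, y), i) = ((fst (\<sigma> (x, i)), y + q (x, i)), snd (\<sigma> (x, i)))"
    if "(x, i) \<in> {1..} \<times> {1..n}" "y \<ge> snd p" for x y i
    using \<sigma>q[THEN bspec, OF that(1)] that(2) by simp
  have "inj_on \<sigma> ({1..} \<times> {1..n})"
  proof (rule inj_onI)
    fix c c' assume cc': "c \<in> {1..} \<times> {1..n}" "c' \<in> {1..} \<times> {1..n}" and eq: "\<sigma> c = \<sigma> c'"
    obtain x i x' i' where c: "c = (x, i)" "c' = (x', i')"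
      by (metis surj_pair)
    \<comment> \<open>The heights \<open>w + q c'\<close> on column \<open>c\<close> and
      \<open>w + q c\<close> on column \<open>c'\<close> both go to height
      \<open>w + q c + q c'\<close>. The absolute values put both in the range where the shifts are
      valid, so injectivity of \<open>g\<close> identifies the columns.\<close>
    define w where "w = snd p + \<bar>q c\<bar> + \<bar>q c'\<bar>"
    have "snd p \<le> w + q c" "snd p \<le> w + q c'"
      by (simp_all add: w_def)
    then have "g ((x, w + q c'), i) = g ((x', w + q c), i')"
      using \<sigma>[of x i "w + q c'"] \<sigma>[of x' i' "w + q c"] cc' eq unfolding c by simp
    then have "((x, w + q c'), i) = ((x', w + q c), i')"
      by (rule injD[OF permutes_inj[OF g]])
    then show "c = c'"
      unfolding c by (metis Pair_inject)
  qed
  moreover have "\<sigma> ` ({1..} \<times> {1..n}) = {1..} \<times> {1..n}"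
  proof
    show "\<sigma> ` ({1..} \<times> {1..n}) \<subseteq> {1..} \<times> {1..n}"
      using mem by (rule image_subsetI)
    \<comment> \<open>For surjectivity, a point of the target column above the image of the low
      strip has its preimage at height at least \<open>snd p\<close>, hence in the upper end of a
      column sent to the target.\<close>
    obtain K where K: "\<And>x y i. 1 \<le> x \<Longrightarrow> 1 \<le> y \<Longrightarrow> y < snd p \<Longrightarrow> i \<in> {1..n} \<Longrightarrow>
        snd (fst (g ((x, y), i))) < K"
      using B2b_strip[OF p(3)] by blast
    show "{1..} \<times> {1..n} \<subseteq> \<sigma> ` ({1..} \<times> {1..n})"
    proof
      fix c :: "int \<times> nat" assume "c \<in> {1..} \<times> {1..n}"
      then obtain x i where c: "c = (x, i)" and xi: "x \<in> {1..}" "i \<in> {1..n}"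
        by blast
      have "((x, max K 1), i) \<in> S_set n"
        using xi by simp
      then obtain u v j where uvj: "g ((u, v), j) = ((x, max K 1), i)" "1 \<le> u" "1 \<le> v" "j \<in> {1..n}"
        using permutes_preimage[OF g] by blast
      have "snd p \<le> v"
        using K[of u v j] uvj by force
      then have "\<sigma> (u, j) = (x, i)"
        using \<sigma>[of u j v] uvj by (auto simp: prod_eq_iff)
      then show "c \<in> \<sigma> ` ({1..} \<times> {1..n})"
        unfolding c using uvj by (intro image_eqI[of _ _ "(u, j)"]) auto
    qed
  qed
  ultimately have "bij_betw \<sigma> ({1..} \<times> {1..n}) ({1..} \<times> {1..n})"
    by (simp add: bij_betw_def)
  moreover have "\<sigma> (x, i) = (x + a i, i)" if "x \<ge> max 1 (fst p)" "i \<in> {1..n}" for x i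
    using \<sigma>[of x i "snd p"] p(1) that by (auto simp: translates_def prod_eq_iff)
  ultimately show ?thesis
    by (rule eventual_translation_sum_zero)
qed

lemma admissible_sum_snd:
  assumes "admissible n a b g"
  shows "(\<Sum>i\<in>{1..n}. b i) = 0"
  using admissible_transposed[OF assms] by (rule admissible_sum_fst)

section \<open>The groups, the homomorphism and its kernel\<close>

lemma B1_tilde_iff: "B1_tilde n p g \<longleftrightarrow> (\<exists>a b. translates n p a b g)"
proof
  assume "\<exists>a b. translates n p a b g"
  then obtain a b where "translates n p a b g"
    by blast
  then show "B1_tilde n p g"
    unfolding B1_tilde_def translates_def by (intro exI[of _ "\<lambda>i. (a i, b i)"]) simp
next
  assume "B1_tilde n p g"
  then obtain m where "\<forall>i\<in>{1..n}. \<forall>x y. x \<ge> fst p \<and> y \<ge> snd p \<longrightarrow>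
      g ((x, y), i) = ((x + fst (m i), y + snd (m i)), i)"
    unfolding B1_tilde_def by blast
  then have "translates n p (\<lambda>i. fst (m i)) (\<lambda>i. snd (m i)) g"
    unfolding translates_def by blast
  then show "\<exists>a b. translates n p a b g"
    by blast
qed

lemma B1_iff: "B1 n p g \<longleftrightarrow> (\<exists>a. translates n p a a g)"
  unfolding B1_def translates_def by blast

lemma carrier_G_tilde: "g \<in> carrier (G_tilde_group n) \<longleftrightarrow> (\<exists>a b. admissible n a b g)"
  unfolding G_tilde_group_def admissible_def B1_tilde_iff by simp blast

lemma carrier_G: "g \<in> carrier (G_group n) \<longleftrightarrow> (\<exists>a. admissible n a a g)"
  unfolding G_group_def admissible_def B1_iff by simp blast

lemma mult_G_tilde [simp]: "g \<otimes>\<^bsub>G_tilde_group n\<^esub> h = h \<circ> g"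
  by (simp add: G_tilde_group_def Sym_def)

lemma one_G_tilde [simp]: "\<one>\<^bsub>G_tilde_group n\<^esub> = id"
  by (simp add: G_tilde_group_def Sym_def)

lemma mult_G [simp]: "g \<otimes>\<^bsub>G_group n\<^esub> h = h \<circ> g"
  by (simp add: G_group_def Sym_def)

lemma group_G_tilde: "group (G_tilde_group n)"
proof (rule groupI)
  fix g assume "g \<in> carrier (G_tilde_group n)"
  then obtain a b where ab: "admissible n a b g"
    by (auto simp: carrier_G_tilde)
  then have "g \<circ> inv' g = id"
    unfolding admissible_def using permutes_inv_o(1) by blast
  then show "\<exists>h\<in>carrier (G_tilde_group n). h \<otimes>\<^bsub>G_tilde_group n\<^esub> g = \<one>\<^bsub>G_tilde_group n\<^esub>"
    using admissible_inv[OF ab] by (intro bexI[of _ "inv' g"]) (simp, unfold carrier_G_tilde, blast)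
qed (auto simp: carrier_G_tilde comp_assoc intro: admissible_id admissible_comp)

text \<open>A permutation determines \<open>a\<close> and \<open>b\<close> only on
  \<open>{1..n}\<close>, so the choice is made among the restricted differences, where it is unique.
  The restriction also makes the value an element of the product group.\<close>

definition slope :: "nat \<Rightarrow> (point \<Rightarrow> point) \<Rightarrow> nat \<Rightarrow> int" where
  "slope n g = (SOME d. \<exists>a b. admissible n a b g \<and> d = (\<lambda>i\<in>{1..n - 1}. a i - b i))"

lemma slope_eq:
  assumes "admissible n a b g"
  shows "slope n g = (\<lambda>i\<in>{1..n - 1}. a i - b i)"
  unfolding slope_def
proof (rule some_equality)
  show "\<exists>a' b'. admissible n a' b' g \<and> (\<lambda>i\<in>{1..n - 1}. a i - b i) = (\<lambda>i\<in>{1..n - 1}. a' i - b' i)"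
    using assms by blast
  fix d assume "\<exists>a' b'. admissible n a' b' g \<and> d = (\<lambda>i\<in>{1..n - 1}. a' i - b' i)"
  then obtain a' b' where ab': "admissible n a' b' g" and d: "d = (\<lambda>i\<in>{1..n - 1}. a' i - b' i)"
    by blast
  have "a' i = a i" "b' i = b i" if "i \<in> {1..n - 1}" for i
    using admissible_unique[OF ab' assms, of i] that by auto
  then show "d = (\<lambda>i\<in>{1..n - 1}. a i - b i)"
    unfolding d by (intro restrict_ext) simp
qed

lemma slope_hom: "slope n \<in> hom (G_tilde_group n) (Z_power (n - 1))"
proof (rule homI)
  fix g assume "g \<in> carrier (G_tilde_group n)"
  then obtain a b where ab: "admissible n a b g"
    by (auto simp: carrier_G_tilde)
  then show "slope n g \<in> carrier (Z_power (n - 1))"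
    by (simp add: slope_eq Z_power_def)
  fix h assume "h \<in> carrier (G_tilde_group n)"
  then obtain c d where cd: "admissible n c d h"
    by (auto simp: carrier_G_tilde)
  show "slope n (g \<otimes>\<^bsub>G_tilde_group n\<^esub> h) = slope n g \<otimes>\<^bsub>Z_power (n - 1)\<^esub> slope n h"
    using slope_eq[OF ab] slope_eq[OF cd] slope_eq[OF admissible_comp[OF ab cd]]
    by (auto simp: Z_power_def fun_eq_iff)
qed

lemma group_Z_power: "group (Z_power k)"
  by (simp add: Z_power_def)

lemma kernel_slope:
  assumes "n \<ge> 1"
  shows "kernel (G_tilde_group n) (Z_power (n - 1)) (slope n) = carrier (G_group n)"
proof
  show "carrier (G_group n) \<subseteq> kernel (G_tilde_group n) (Z_power (n - 1)) (slope n)"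
    by (force simp: kernel_def carrier_G carrier_G_tilde slope_eq Z_power_def)
  show "kernel (G_tilde_group n) (Z_power (n - 1)) (slope n) \<subseteq> carrier (G_group n)"
  proof
    fix g assume g: "g \<in> kernel (G_tilde_group n) (Z_power (n - 1)) (slope n)"
    then obtain a b where ab: "admissible n a b g"
      by (auto simp: kernel_def carrier_G_tilde)
    have "(\<lambda>i\<in>{1..n - 1}. a i - b i) = (\<lambda>i\<in>{1..n - 1}. 0)"
      using g slope_eq[OF ab] by (simp add: kernel_def Z_power_def)
    then have eq: "a i = b i" if "i \<in> {1..n - 1}" for i
      using that by (metis (mono_tags, lifting) restrict_apply' right_minus_eq)
    have "{1..n} = insert n {1..n - 1}"
      using assms by auto
    then have "a n + (\<Sum>i\<in>{1..n - 1}. a i) = b n + (\<Sum>i\<in>{1..n - 1}. b i)"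
      using admissible_sum_fst[OF ab] admissible_sum_snd[OF ab] assms by simp
    moreover have "(\<Sum>i\<in>{1..n - 1}. a i) = (\<Sum>i\<in>{1..n - 1}. b i)"
      using eq by (intro sum.cong) auto
    ultimately have "a n = b n"
      by simp
    then have "a i = b i" if "i \<in> {1..n}" for i
      using eq[of i] that by (cases "i = n") auto
    \<comment> \<open>Only the values on \<open>{1..n}\<close> enter \<open>translates\<close>, so
      \<open>b\<close> may be replaced by \<open>a\<close>.\<close>
    then have "admissible n a a g"
      using ab by (simp add: admissible_def translates_def)
    then show "g \<in> carrier (G_group n)"
      by (auto simp: carrier_G)
  qed
qed

section \<open>Surjectivity by shifts along glued rows\<close>

text \<open>The rays \<open>l = i\<close> and \<open>l = j\<close> of each row are glued to a line, on which the point \<open>x\<close> of ray \<open>i\<close>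
  has coordinate \<open>x\<close> and the point \<open>x\<close> of ray \<open>j\<close> has coordinate \<open>1 - x\<close>; this line is moved by \<open>k\<close>.\<close>

definition line_shift :: "nat \<Rightarrow> nat \<Rightarrow> int \<Rightarrow> point \<Rightarrow> point" where
  "line_shift i j k = (\<lambda>((x, y), l).
     if x < 1 \<or> y < 1 \<or> l \<notin> {i, j} then ((x, y), l)
     else let t = (if l = i then x else 1 - x) + k in
       if t \<ge> 1 then ((t, y), i) else ((1 - t, y), j))"

lemma line_shift_inverse:
  assumes "i \<noteq> j"
  shows "line_shift i j (- k) (line_shift i j k P) = P"
  using assms by (cases P) (auto simp: line_shift_def Let_def)

lemma line_shift_permutes:
  assumes "i \<in> {1..n}" "j \<in> {1..n}" "i \<noteq> j"
  shows "line_shift i j k permutes S_set n"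
proof (rule bij_permutesI)
  show "bij (line_shift i j k)"
    using line_shift_inverse[OF assms(3), of k] line_shift_inverse[OF assms(3), of "- k"]
    by (intro o_bij[of "line_shift i j (- k)"]) (auto simp: fun_eq_iff)
  show "line_shift i j k P = P" if "P \<notin> S_set n" for P
    using that assms by (cases P) (auto simp: line_shift_def)
qed

lemma line_shift_admissible:
  assumes ij: "i \<in> {1..n}" "j \<in> {1..n}" "i \<noteq> j"
  shows "admissible n (\<lambda>l. if l = i then k else if l = j then - k else 0) (\<lambda>_. 0) (line_shift i j k)"
proof (rule admissibleI[OF line_shift_permutes[OF ij]])
  \<comment> \<open>For \<open>x\<close> beyond the absolute value of \<open>k\<close> no point
    changes its ray: on ray \<open>i\<close> the new coordinate \<open>x + k\<close> is at least 1,
    on ray \<open>j\<close> the line coordinate \<open>1 - x + k\<close> is at most 0 and stands for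
    the point \<open>x - k\<close>.\<close>
  let ?p = "(\<bar>k\<bar> + 1, 1) :: int \<times> int"
  show "translates n ?p (\<lambda>l. if l = i then k else if l = j then - k else 0) (\<lambda>_. 0) (line_shift i j k)"
    using ij by (auto simp: translates_def line_shift_def Let_def)
  show "B2b n ?p (line_shift i j k)"
    unfolding B2b_def
  proof (intro ballI)
    fix y :: int and l assume "y \<in> Y_set" "l \<in> {1..n}"
    then show "\<exists>r. \<exists>y'\<in>Y_set. \<exists>l'\<in>{1..n}. \<forall>x\<ge>fst ?p. line_shift i j k ((x, y), l) = ((x + r, y'), l')"
      using ij by (intro exI[of _ "if l = i then k else if l = j then - k else 0"] bexI[of _ y] bexI[of _ l])
        (auto simp: line_shift_def Y_set_def Let_def)
  qed
  show "B2a n ?p (line_shift i j k)"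
    unfolding B2a_def
  proof (intro ballI)
    fix x :: int and l assume xl: "x \<in> X_set" "l \<in> {1..n}"
    \<comment> \<open>All rows are moved alike, so the image of the lowest point of a column
      determines that of the whole column, with vertical shift 0.\<close>
    obtain x' l' where P: "line_shift i j k ((x, 1), l) = ((x', 1), l')"
      using xl by (cases "l = i"; cases "l = j"; cases "x + k \<ge> 1"; cases "1 - x + k \<ge> 1")
        (simp_all add: line_shift_def X_set_def Let_def)
    have "((x', 1), l') \<in> S_set n"
      using permutes_in_image[OF line_shift_permutes[OF ij], of k "((x, 1), l)"] xl P
      by (simp add: X_set_def)
    moreover have "\<forall>y\<ge>1. line_shift i j k ((x, y), l) = ((x', y + 0), l')"
      using P xl by (auto simp: line_shift_def X_set_def Let_def split: if_splits)
    ultimately show "\<exists>q. \<exists>x'\<in>X_set. \<exists>l'\<in>{1..n}. \<forall>y\<ge>snd ?p. line_shift i j k ((x, y), l) = ((x', y + q), l')"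
      by (intro exI[of _ 0] bexI[of _ x'] bexI[of _ l']) (simp_all add: X_set_def)
  qed
qed

text \<open>The preimage is built by induction on the support \<open>F\<close>: composing with a
  shift along the rays \<open>i\<close> and \<open>n\<close> adds \<open>f i\<close> at place
  \<open>i\<close>. Its other effect, at place \<open>n\<close>, lies outside the index set
  \<open>{1..n - 1}\<close>.\<close>

lemma slope_surj: "slope n ` carrier (G_tilde_group n) = carrier (Z_power (n - 1))"
proof
  show "slope n ` carrier (G_tilde_group n) \<subseteq> carrier (Z_power (n - 1))"
    using slope_hom by (auto simp: hom_def)
  have supported: "(\<lambda>l\<in>{1..n - 1}. if l \<in> F then f l else 0) \<in> slope n ` carrier (G_tilde_group n)"
    if "finite F" "F \<subseteq> {1..n - 1}" for f F
    using that
  proof (induction F)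
    case empty
    show ?case
      using admissible_id[of n]
      by (intro image_eqI[of _ _ id]) (unfold slope_eq[OF admissible_id] carrier_G_tilde, auto)
  next
    case (insert i F)
    then obtain g where g: "g \<in> carrier (G_tilde_group n)"
      and slope_g: "slope n g = (\<lambda>l\<in>{1..n - 1}. if l \<in> F then f l else 0)"
      by (metis (no_types, lifting) imageE insert_subset)
    then obtain a b where ab: "admissible n a b g"
      by (auto simp: carrier_G_tilde)
    have i: "i \<in> {1..n}" "n \<in> {1..n}" "i \<noteq> n"
      using insert.prems by auto
    note adm = admissible_comp[OF ab line_shift_admissible[OF i, of "f i"]]
    have "slope n (line_shift i n (f i) \<circ> g) =
        (\<lambda>l\<in>{1..n - 1}. if l \<in> insert i F then f l else 0)"
    proof
      fix l
      show "slope n (line_shift i n (f i) \<circ> g) l =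
          (\<lambda>l\<in>{1..n - 1}. if l \<in> insert i F then f l else 0) l"
        using slope_eq[OF adm] slope_eq[OF ab] fun_cong[OF slope_g, of l] insert.hyps by auto
    qed
    moreover have "line_shift i n (f i) \<circ> g \<in> carrier (G_tilde_group n)"
      using adm unfolding carrier_G_tilde by blast
    ultimately show ?case
      by (metis (no_types, lifting) image_eqI)
  qed
  show "carrier (Z_power (n - 1)) \<subseteq> slope n ` carrier (G_tilde_group n)"
  proof
    fix f assume "f \<in> carrier (Z_power (n - 1))"
    then have "f = (\<lambda>l\<in>{1..n - 1}. if l \<in> {1..n - 1} then f l else 0)"
      by (auto simp: Z_power_def PiE_iff extensional_def)
    then show "f \<in> slope n ` carrier (G_tilde_group n)"
      using supported[of "{1..n - 1}" f] by simp
  qed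
qed

theorem mainTheorem3:
  fixes n :: nat
  assumes "n \<ge> 1"
  shows "carrier (G_group n) \<lhd> G_tilde_group n
    \<and> G_tilde_group n Mod carrier (G_group n) \<cong> Z_power (n - 1)
    \<and> (\<exists>\<phi>. id \<in> mon (G_group n) (G_tilde_group n)
          \<and> \<phi> \<in> epi (G_tilde_group n) (Z_power (n - 1))
          \<and> kernel (G_tilde_group n) (Z_power (n - 1)) \<phi> = id ` carrier (G_group n))"
proof -
  \<comment> \<open>Normality and the quotient follow from the first isomorphism theorem for
    \<open>slope n\<close>, which also serves as the second map of the exact sequence; the first is
    the inclusion \<open>id\<close>.\<close>
  interpret slope: group_hom "G_tilde_group n" "Z_power (n - 1)" "slope n"
    by (intro group_hom.intro group_hom_axioms.intro group_G_tilde group_Z_power slope_hom)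
  have "id \<in> mon (G_group n) (G_tilde_group n)"
    by (fastforce simp: mon_def hom_def carrier_G carrier_G_tilde)
  moreover have "slope n \<in> epi (G_tilde_group n) (Z_power (n - 1))"
    unfolding epi_def using slope_hom slope_surj by blast
  ultimately show ?thesis
    using slope.normal_kernel slope.FactGroup_iso[OF slope_surj] kernel_slope[OF assms]
    by auto
qed

end
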